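(* Let $n\ge 2$ be an integer and let $A=\{1,-1\}\subseteq \mathbb{Z}_n$. Then: (i) $C_{A,\mathbf 1}(n)=2C_A(n)$ and $D_A(n)+1\le D_{A,\mathbf 1}(n)\le 2D_A(n)$; (ii) if $n$ is odd, then $E_{A,\mathbf 1}(n)=2n-1$; (iii) if $n$ is even, then $E_A(n)\le E_{A,\mathbf 1}(n)\le n-2+D_{A,\mathbf 1}(n)$.
   Context: $\mathbb{Z}_n$ denotes the ring $\mathbb{Z}/n\mathbb{Z}$. A sequence of length $k$ in a set $X$ is an element of $X^k$. A subsequence is obtained by selecting terms at some positions and is always nonempty. In a subsequence of consecutive terms, the selected positions are consecutive. Let $A=\{1,-1\}\subseteq\mathbb{Z}_n$. A sequence $(x_1,\ldots,x_k)$ in $\mathbb{Z}_n$ is an $A$-weighted zero-sum sequence if there exist $a_1,\ldots,a_k\in A$ with $a_1x_1+\cdots+a_kx_k=0$ in $\mathbb{Z}_n$. It is an $(A,\mathbf 1)$-weighted zero-sum sequence (where $\mathbf 1=\{1\}$) if there exist $a_1,\ldots,a_k\in A$ with both $a_1x_1+\cdots+a_kx_k=0$ and $a_1+\cdots+a_k=0$ in $\mathbb{Z}_n$. $D_A(n)$ (resp. $D_{A,\mathbf 1}(n)$) is the least positive integer $k$ such that every sequence of length $k$ in $\mathbb{Z}_n$ has an $A$-weighted (resp. $(A,\mathbf 1)$-weighted) zero-sum subsequence. $C_A(n)$ (resp. $C_{A,\mathbf 1}(n)$) is the least positive integer $k$ such that every sequence of length $k$ in $\mathbb{Z}_n$ has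 an $A$-weighted (resp. $(A,\mathbf 1)$-weighted) zero-sum subsequence of consecutive terms. $E_A(n)$ (resp. $E_{A,\mathbf 1}(n)$) is the least positive integer $k$ such that every sequence of length $k$ in $\mathbb{Z}_n$ has an $A$-weighted (resp. $(A,\mathbf 1)$-weighted) zero-sum subsequence of length $n$. *)

theory Defs
  imports "HOL-Number_Theory.Residues" "HOL-Library.Sublist"
begin

abbreviation Zn :: "nat \<Rightarrow> int ring" where
  "Zn n \<equiv> residue_ring (int n)"

definition weighted_zero_sum :: "nat \<Rightarrow> int set \<Rightarrow> int list \<Rightarrow> bool" where
  "weighted_zero_sum n A xs \<longleftrightarrow>
     (\<exists>as. length as = length xs \<and> set as \<subseteq> A \<and>
       (\<Oplus>\<^bsub>Zn n\<^esub> i \<in> {..<length xs}. as ! i \<otimes>\<^bsub>Zn n\<^esub> xs ! i) = \<zero>\<^bsub>Zn n\<^esub>)"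

definition weighted_zero_sum_one :: "nat \<Rightarrow> int set \<Rightarrow> int list \<Rightarrow> bool" where
  "weighted_zero_sum_one n A xs \<longleftrightarrow>
     (\<exists>as. length as = length xs \<and> set as \<subseteq> A \<and>
       (\<Oplus>\<^bsub>Zn n\<^esub> i \<in> {..<length xs}. as ! i \<otimes>\<^bsub>Zn n\<^esub> xs ! i) = \<zero>\<^bsub>Zn n\<^esub> \<and>
       (\<Oplus>\<^bsub>Zn n\<^esub> i \<in> {..<length xs}. as ! i) = \<zero>\<^bsub>Zn n\<^esub>)"

definition seqs :: "nat \<Rightarrow> nat \<Rightarrow> int list set" where
  "seqs n k = {xs. length xs = k \<and> set xs \<subseteq> carrier (Zn n)}"

text \<open>
  Subsequences are always nonempty. The library relation \<^const>\<open>subseq\<close> allows arbitrary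
  positions, whereas \<^const>\<open>sublist\<close> requires consecutive ones.
\<close>

definition D_const :: "nat \<Rightarrow> (int list \<Rightarrow> bool) \<Rightarrow> nat" where
  "D_const n P = (LEAST k. 0 < k \<and> (\<forall>xs \<in> seqs n k. \<exists>ys. ys \<noteq> [] \<and> subseq ys xs \<and> P ys))"

definition C_const :: "nat \<Rightarrow> (int list \<Rightarrow> bool) \<Rightarrow> nat" where
  "C_const n P = (LEAST k. 0 < k \<and> (\<forall>xs \<in> seqs n k. \<exists>ys. ys \<noteq> [] \<and> sublist ys xs \<and> P ys))"

definition E_const :: "nat \<Rightarrow> (int list \<Rightarrow> bool) \<Rightarrow> nat" where
  "E_const n P = (LEAST k. 0 < k \<and>
     (\<forall>xs \<in> seqs n k. \<exists>ys. ys \<noteq> [] \<and> subseq ys xs \<and> length ys = n \<and> P ys))"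

definition D_w :: "int set \<Rightarrow> nat \<Rightarrow> nat" where
  "D_w A n = D_const n (weighted_zero_sum n A)"

definition D_w1 :: "int set \<Rightarrow> nat \<Rightarrow> nat" where
  "D_w1 A n = D_const n (weighted_zero_sum_one n A)"

definition C_w :: "int set \<Rightarrow> nat \<Rightarrow> nat" where
  "C_w A n = C_const n (weighted_zero_sum n A)"

definition C_w1 :: "int set \<Rightarrow> nat \<Rightarrow> nat" where
  "C_w1 A n = C_const n (weighted_zero_sum_one n A)"

definition E_w :: "int set \<Rightarrow> nat \<Rightarrow> nat" where
  "E_w A n = E_const n (weighted_zero_sum n A)"

definition E_w1 :: "int set \<Rightarrow> nat \<Rightarrow> nat" where
  "E_w1 A n = E_const n (weighted_zero_sum_one n A)"

end

theory Submission
  imports Defs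
begin

text \<open>
  A choice of signs splits the terms of a sequence into those counted with \<open>+\<close> and those
  counted with \<open>-\<close>. So a weighted zero-sum sequence is one whose multiset of terms is
  \<open>P + Q\<close> with congruent sums, and the condition on the weights says that the sizes of \<open>P\<close> and
  \<open>Q\<close> are congruent as well; such a multiset is called balanced below. The ring sums are
  translated to this form once and for all in \<open>weighted_zero_sum_iff\<close>.

  The constants \<open>C\<close> and \<open>D\<close>. Cut a sequence of even length into
  consecutive pairs and replace each pair by its difference. A signed zero-sum among the differences gives each pair the weights \<open>1, -1\<close> or
  \<open>-1, 1\<close>, so it is a balanced zero-sum of the original terms, of twice the length, and
  consecutive if the differences were: both constants at most double
  (\<open>hits_balanced_double\<close>). Conversely, take a sequence without signed zero-sums and insert
  zeros. A balanced zero-sum of the new sequence stays a signed zero-sum when its zeros are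
  dropped, hence consists of zeros only, and it needs at least two of them
  (\<open>not_hits_balanced_padded\<close>). For arbitrary positions one extra zero is harmless, and for
  consecutive terms a zero may be put into every gap and at both ends, which
  turns length \<open>c - 1\<close> into \<open>2 c - 1\<close>.

  The constant \<open>E\<close> for odd \<open>n\<close>. A balanced multiset of size \<open>n\<close> has all its weights
  equal, so the question is that of Erdos, Ginzburg and Ziv about plain zero-sums of length
  \<open>n\<close>. For a prime \<open>p\<close>, sorting the residues yields either \<open>p\<close> equal ones or \<open>p - 1\<close> pairs of
  distinct ones; in the second case choosing one element of each pair already produces every
  residue as a sum, since each pair enlarges the set of sums. The property is then
  multiplicative in \<open>n\<close>.

  The constant \<open>E\<close> for even \<open>n\<close>. Balanced multisets have even size. Split the given terms into
  pairs of equal elements and a set \<open>B\<close> of distinct residues. Since \<open>B\<close> has at most \<open>n\<close>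
  elements, the pairs account for at least \<open>d - 2\<close> terms, where \<open>d\<close> is the balanced Davenport
  constant. A largest balanced multiset inside \<open>B\<close> of size at most \<open>n\<close> misses \<open>n\<close> by no more than
  the number of terms in pairs, for otherwise \<open>d\<close> elements of \<open>B\<close> are left and it can be enlarged
  by at most \<open>d\<close> elements without exceeding \<open>n\<close>. Pairs of equal elements, being balanced, fill
  the gap (\<open>E_even_upper\<close>).
\<close>

section \<open>Signed and balanced zero-sum multisets\<close>

definition signed_zero_sum :: "nat \<Rightarrow> int multiset \<Rightarrow> bool" where
  "signed_zero_sum n M \<longleftrightarrow> (\<exists>P Q. M = P + Q \<and> [\<Sum>\<^sub># P = \<Sum>\<^sub># Q] (mod int n))"

definition balanced_zero_sum :: "nat \<Rightarrow> int multiset \<Rightarrow> bool" where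
  "balanced_zero_sum n M \<longleftrightarrow>
     (\<exists>P Q. M = P + Q \<and> [\<Sum>\<^sub># P = \<Sum>\<^sub># Q] (mod int n) \<and> [size P = size Q] (mod n))"

lemma balanced_imp_signed: "balanced_zero_sum n M \<Longrightarrow> signed_zero_sum n M"
  unfolding balanced_zero_sum_def signed_zero_sum_def by blast

lemma balanced_add:
  assumes "balanced_zero_sum n M" "balanced_zero_sum n N"
  shows "balanced_zero_sum n (M + N)"
proof -
  obtain P Q where PQ: "M = P + Q" "[\<Sum>\<^sub># P = \<Sum>\<^sub># Q] (mod int n)" "[size P = size Q] (mod n)"
    using assms(1) unfolding balanced_zero_sum_def by blast
  obtain P' Q' where PQ': "N = P' + Q'" "[\<Sum>\<^sub># P' = \<Sum>\<^sub># Q'] (mod int n)"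
      "[size P' = size Q'] (mod n)"
    using assms(2) unfolding balanced_zero_sum_def by blast
  have "M + N = (P + P') + (Q + Q')" using PQ(1) PQ'(1) by (simp add: ac_simps)
  moreover have "[\<Sum>\<^sub># (P + P') = \<Sum>\<^sub># (Q + Q')] (mod int n)"
    using cong_add[OF PQ(2) PQ'(2)] by simp
  moreover have "[size (P + P') = size (Q + Q')] (mod n)"
    using cong_add[OF PQ(3) PQ'(3)] by simp
  ultimately show ?thesis unfolding balanced_zero_sum_def by blast
qed

lemma balanced_double: "balanced_zero_sum n (M + M)"
  unfolding balanced_zero_sum_def by (intro exI[of _ M]) simp

lemma balanced_empty: "balanced_zero_sum n {#}"
  using balanced_double[of n "{#}"] by simp

lemma balanced_even_size:
  assumes "balanced_zero_sum n M" "even n"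
  shows "even (size M)"
proof -
  obtain P Q where PQ: "M = P + Q" "[size P = size Q] (mod n)"
    using assms(1) unfolding balanced_zero_sum_def by blast
  have "[size P = size Q] (mod 2)" using cong_dvd_modulus_nat PQ(2) assms(2) by blast
  then show ?thesis using PQ(1) by (simp add: cong_def) presburger
qed

text \<open>
  A single term has weight sum \<open>1\<close> or \<open>-1\<close>, which is nonzero modulo \<open>n \<ge> 2\<close>.
\<close>

lemma balanced_size_ge_2:
  assumes "balanced_zero_sum n M" "M \<noteq> {#}" "n \<ge> 2"
  shows "size M \<ge> 2"
proof (rule ccontr)
  assume "\<not> ?thesis"
  then have "size M = 1" using assms(2) by (metis One_nat_def less_2_cases_iff not_le size_eq_0_iff_empty)
  moreover obtain P Q where PQ: "M = P + Q" "[size P = size Q] (mod n)"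
    using assms(1) unfolding balanced_zero_sum_def by blast
  ultimately have "size P + size Q = 1" by simp
  then have "size P = 0 \<and> size Q = 1 \<or> size P = 1 \<and> size Q = 0" by linarith
  then show False using PQ(2) assms(3) by (auto simp: cong_def)
qed

lemma signed_drop_zeros:
  assumes "signed_zero_sum n M"
  shows "signed_zero_sum n (filter_mset (\<lambda>x. x \<noteq> 0) M)"
proof -
  obtain P Q where PQ: "M = P + Q" "[\<Sum>\<^sub># P = \<Sum>\<^sub># Q] (mod int n)"
    using assms unfolding signed_zero_sum_def by blast
  have sum: "\<Sum>\<^sub># (filter_mset (\<lambda>x. x \<noteq> 0) R) = \<Sum>\<^sub># R" for R :: "int multiset"
    by (induction R) auto
  show ?thesis unfolding signed_zero_sum_def
    by (rule exI[of _ "filter_mset (\<lambda>x. x \<noteq> 0) P"], rule exI[of _ "filter_mset (\<lambda>x. x \<noteq> 0) Q"])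
      (simp add: PQ sum)
qed

section \<open>From ring weights to multisets\<close>

lemma finsum_Zn:
  assumes n: "n \<ge> 2" and "finite S" and "\<And>i. i \<in> S \<Longrightarrow> f i \<in> carrier (Zn n)"
  shows "(\<Oplus>\<^bsub>Zn n\<^esub> i \<in> S. f i) = (\<Sum>i\<in>S. f i) mod int n"
proof -
  interpret residues "int n" "Zn n" by unfold_locales (use n in auto)
  show ?thesis using assms(2,3)
  proof (induction S rule: finite_induct)
    case empty
    then show ?case by (simp add: res_zero_eq)
  next
    case (insert i S)
    have "(\<Oplus>\<^bsub>Zn n\<^esub> i \<in> insert i S. f i) = f i \<oplus>\<^bsub>Zn n\<^esub> (\<Oplus>\<^bsub>Zn n\<^esub> i \<in> S. f i)"
      using insert by (intro finsum_insert) auto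
    then show ?case using insert by (simp add: res_add_eq mod_simps)
  qed
qed

lemma carrier_Zn: "carrier (Zn n) = {0..<int n}"
  by (auto simp: residue_ring_def)

text \<open>
  The signs are described by congruences because \<open>-1\<close> is represented in the ring by \<open>n - 1\<close>.
\<close>

lemma signs_to_parts:
  assumes "length as = length ys" "\<forall>a \<in> set as. [a = 1] (mod m) \<or> [a = -1] (mod m)"
  shows "\<exists>P Q. mset ys = P + Q \<and> [(\<Sum>i<length ys. as ! i * ys ! i) = \<Sum>\<^sub># P - \<Sum>\<^sub># Q] (mod m)
    \<and> [(\<Sum>i<length ys. as ! i) = int (size P) - int (size Q)] (mod m)"
  using assms
proof (induction as ys rule: list_induct2)
  case Nil
  then show ?case by auto
next
  case (Cons a as y ys)
  then obtain P Q where PQ: "mset ys = P + Q"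
    "[(\<Sum>i<length ys. as ! i * ys ! i) = \<Sum>\<^sub># P - \<Sum>\<^sub># Q] (mod m)"
    "[(\<Sum>i<length ys. as ! i) = int (size P) - int (size Q)] (mod m)" by auto
  from Cons.prems consider "[a = 1] (mod m)" | "[a = -1] (mod m)" by auto
  then show ?case
  proof cases
    case 1
    have "[a * y + (\<Sum>i<length ys. as ! i * ys ! i) = 1 * y + (\<Sum>\<^sub># P - \<Sum>\<^sub># Q)] (mod m)"
      "[a + (\<Sum>i<length ys. as ! i) = 1 + (int (size P) - int (size Q))] (mod m)"
      using 1 PQ(2,3) by (intro cong_add cong_mult; simp)+
    then show ?thesis using PQ(1)
      by (intro exI[of _ "add_mset y P"] exI[of _ Q])
        (simp add: sum.lessThan_Suc_shift algebra_simps del: sum.lessThan_Suc)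
  next
    case 2
    have "[a * y + (\<Sum>i<length ys. as ! i * ys ! i) = (-1) * y + (\<Sum>\<^sub># P - \<Sum>\<^sub># Q)] (mod m)"
      "[a + (\<Sum>i<length ys. as ! i) = -1 + (int (size P) - int (size Q))] (mod m)"
      using 2 PQ(2,3) by (intro cong_add cong_mult; simp)+
    then show ?thesis using PQ(1)
      by (intro exI[of _ P] exI[of _ "add_mset y Q"])
        (simp add: sum.lessThan_Suc_shift algebra_simps del: sum.lessThan_Suc)
  qed
qed

text \<open>
  When \<open>n = 2\<close> the residues \<open>u\<close> and \<open>v\<close> coincide, so the signs cannot be read off from \<open>as\<close>; the
  statement therefore starts from \<open>P\<close> and \<open>Q\<close> and only asks for some list of weights.
\<close>

lemma parts_to_signs:
  assumes "mset ys = P + Q" "[u = 1] (mod m)" "[v = -1] (mod m)"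
  shows "\<exists>as. length as = length ys \<and> set as \<subseteq> {u, v}
    \<and> [(\<Sum>i<length ys. as ! i * ys ! i) = \<Sum>\<^sub># P - \<Sum>\<^sub># Q] (mod m)
    \<and> [(\<Sum>i<length ys. as ! i) = int (size P) - int (size Q)] (mod m)"
  using assms(1)
proof (induction ys arbitrary: P Q)
  case Nil
  then show ?case by auto
next
  case (Cons y ys)
  have "y \<in># P + Q" using Cons.prems by (metis list.set_intros(1) set_mset_mset)
  then consider P' where "P = add_mset y P'" | Q' where "Q = add_mset y Q'"
    by (metis mset_add union_iff)
  then show ?case
  proof cases
    case 1
    then have "mset ys = P' + Q" using Cons.prems by simp
    from Cons.IH[OF this] obtain as where as: "length as = length ys" "set as \<subseteq> {u, v}"
      "[(\<Sum>i<length ys. as ! i * ys ! i) = \<Sum>\<^sub># P' - \<Sum>\<^sub># Q] (mod m)"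
      "[(\<Sum>i<length ys. as ! i) = int (size P') - int (size Q)] (mod m)" by blast
    have "[u * y + (\<Sum>i<length ys. as ! i * ys ! i) = 1 * y + (\<Sum>\<^sub># P' - \<Sum>\<^sub># Q)] (mod m)"
      "[u + (\<Sum>i<length ys. as ! i) = 1 + (int (size P') - int (size Q))] (mod m)"
      using assms(2) as(3,4) by (intro cong_add cong_mult; simp)+
    then show ?thesis using as(1,2) 1
      by (intro exI[of _ "u # as"]) (simp add: sum.lessThan_Suc_shift algebra_simps del: sum.lessThan_Suc)
  next
    case 2
    then have "mset ys = P + Q'" using Cons.prems by simp
    from Cons.IH[OF this] obtain as where as: "length as = length ys" "set as \<subseteq> {u, v}"
      "[(\<Sum>i<length ys. as ! i * ys ! i) = \<Sum>\<^sub># P - \<Sum>\<^sub># Q'] (mod m)"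
      "[(\<Sum>i<length ys. as ! i) = int (size P) - int (size Q')] (mod m)" by blast
    have "[v * y + (\<Sum>i<length ys. as ! i * ys ! i) = (-1) * y + (\<Sum>\<^sub># P - \<Sum>\<^sub># Q')] (mod m)"
      "[v + (\<Sum>i<length ys. as ! i) = -1 + (int (size P) - int (size Q'))] (mod m)"
      using assms(3) as(3,4) by (intro cong_add cong_mult; simp)+
    then show ?thesis using as(1,2) 2
      by (intro exI[of _ "v # as"]) (simp add: sum.lessThan_Suc_shift algebra_simps del: sum.lessThan_Suc)
  qed
qed

lemma weighted_zero_sum_iff:
  assumes n: "n \<ge> 2" and A: "A = {\<one>\<^bsub>Zn n\<^esub>, \<ominus>\<^bsub>Zn n\<^esub> \<one>\<^bsub>Zn n\<^esub>}"
  shows "weighted_zero_sum n A = (\<lambda>ys. signed_zero_sum n (mset ys))" (is ?signed)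
    and "weighted_zero_sum_one n A = (\<lambda>ys. balanced_zero_sum n (mset ys))" (is ?balanced)
proof -
  interpret residues "int n" "Zn n" by unfold_locales (use n in auto)
  have A': "A = {1, (-1) mod int n}" using n by (simp add: A res_one_eq res_neg_eq)
  have signs: "[1 = 1] (mod int n)" "[(-1) mod int n = -1] (mod int n)" by (simp_all add: cong_def)
  have Acong: "\<forall>a \<in> A. [a = 1] (mod int n) \<or> [a = -1] (mod int n)" using signs A' by auto
  have prods: "(\<Oplus>\<^bsub>Zn n\<^esub> i \<in> {..<length ys}. as ! i \<otimes>\<^bsub>Zn n\<^esub> ys ! i) = \<zero>\<^bsub>Zn n\<^esub>
      \<longleftrightarrow> [(\<Sum>i<length ys. as ! i * ys ! i) = 0] (mod int n)" for as ys
  proof -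
    have "(\<Oplus>\<^bsub>Zn n\<^esub> i \<in> {..<length ys}. as ! i \<otimes>\<^bsub>Zn n\<^esub> ys ! i)
        = (\<Sum>i<length ys. (as ! i * ys ! i) mod int n) mod int n"
      using n by (subst finsum_Zn) (auto simp: res_mult_eq carrier_Zn)
    then show ?thesis by (simp add: res_zero_eq cong_def mod_sum_eq)
  qed
  have weights: "(\<Oplus>\<^bsub>Zn n\<^esub> i \<in> {..<length ys}. as ! i) = \<zero>\<^bsub>Zn n\<^esub>
      \<longleftrightarrow> [(\<Sum>i<length ys. as ! i) = 0] (mod int n)"
    if "length as = length ys" "set as \<subseteq> A" for as ys
  proof -
    have "A \<subseteq> carrier (Zn n)" using n by (auto simp: A' carrier_Zn)
    then have "as ! i \<in> carrier (Zn n)" if "i < length ys" for i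
      using that \<open>length as = length ys\<close> \<open>set as \<subseteq> A\<close> nth_mem[of i as] by (metis subsetD)
    then have "(\<Oplus>\<^bsub>Zn n\<^esub> i \<in> {..<length ys}. as ! i) = (\<Sum>i<length ys. as ! i) mod int n"
      using n by (subst finsum_Zn) auto
    then show ?thesis by (simp add: res_zero_eq cong_def)
  qed
  have diff: "[x = a - b] (mod int n) \<Longrightarrow> [x = 0] (mod int n) \<longleftrightarrow> [a = b] (mod int n)" for x a b
    by (metis cong_diff_iff_cong_0 cong_sym cong_trans)
  have sizes: "[int a = int b] (mod int n) \<longleftrightarrow> [a = b] (mod n)" for a b
    by (rule cong_int_iff)
  show ?signed
  proof (intro ext iffI)
    fix ys assume "weighted_zero_sum n A ys"
    then obtain as where as: "length as = length ys" "set as \<subseteq> A"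
      "[(\<Sum>i<length ys. as ! i * ys ! i) = 0] (mod int n)"
      unfolding weighted_zero_sum_def prods by blast
    then obtain P Q where "mset ys = P + Q"
        "[(\<Sum>i<length ys. as ! i * ys ! i) = \<Sum>\<^sub># P - \<Sum>\<^sub># Q] (mod int n)"
      using signs_to_parts[OF as(1)] Acong by blast
    then show "signed_zero_sum n (mset ys)"
      using as(3) diff unfolding signed_zero_sum_def by blast
  next
    fix ys assume "signed_zero_sum n (mset ys)"
    then obtain P Q where PQ: "mset ys = P + Q" "[\<Sum>\<^sub># P = \<Sum>\<^sub># Q] (mod int n)"
      unfolding signed_zero_sum_def by blast
    from parts_to_signs[OF PQ(1) signs] PQ(2) show "weighted_zero_sum n A ys"
      unfolding weighted_zero_sum_def prods A' using diff by blast
  qed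
  show ?balanced
  proof (intro ext iffI)
    fix ys assume "weighted_zero_sum_one n A ys"
    then obtain as where as: "length as = length ys" "set as \<subseteq> A"
      "[(\<Sum>i<length ys. as ! i * ys ! i) = 0] (mod int n)"
      "[(\<Sum>i<length ys. as ! i) = 0] (mod int n)"
      unfolding weighted_zero_sum_one_def prods using weights by blast
    then obtain P Q where "mset ys = P + Q"
        "[(\<Sum>i<length ys. as ! i * ys ! i) = \<Sum>\<^sub># P - \<Sum>\<^sub># Q] (mod int n)"
        "[(\<Sum>i<length ys. as ! i) = int (size P) - int (size Q)] (mod int n)"
      using signs_to_parts[OF as(1)] Acong by blast
    then show "balanced_zero_sum n (mset ys)"
      using as(3,4) diff sizes unfolding balanced_zero_sum_def by blast
  next
    fix ys assume "balanced_zero_sum n (mset ys)"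
    then obtain P Q where PQ: "mset ys = P + Q" "[\<Sum>\<^sub># P = \<Sum>\<^sub># Q] (mod int n)"
        "[int (size P) = int (size Q)] (mod int n)"
      unfolding balanced_zero_sum_def sizes by blast
    from parts_to_signs[OF PQ(1) signs] obtain as where as: "length as = length ys" "set as \<subseteq> A"
      "[(\<Sum>i<length ys. as ! i * ys ! i) = \<Sum>\<^sub># P - \<Sum>\<^sub># Q] (mod int n)"
      "[(\<Sum>i<length ys. as ! i) = int (size P) - int (size Q)] (mod int n)"
      unfolding A' by blast
    then show "weighted_zero_sum_one n A ys"
      unfolding weighted_zero_sum_one_def prods using weights[OF as(1,2)] diff PQ(2,3) by blast
  qed
qed


section \<open>The Erdos-Ginzburg-Ziv theorem\<close>

lemma mset_segment_subseteq: "mset (take k (drop i xs)) \<subseteq># mset xs"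
  by (metis append_take_drop_id mset_append mset_subset_eq_add_left mset_subset_eq_add_right subset_mset.order_trans)

lemma submset_of_size:
  assumes "k \<le> size M"
  obtains N where "N \<subseteq># M" "size N = k"
proof -
  obtain xs where xs: "mset xs = M" using ex_mset by blast
  show ?thesis
  proof (rule that)
    show "mset (take k xs) \<subseteq># M" using mset_segment_subseteq[of k 0 xs] xs by simp
    show "size (mset (take k xs)) = k" using assms xs by auto
  qed
qed

text \<open>
  The rigidity behind the growth of sumsets: a nonzero residue generates the additive
  group modulo a prime.
\<close>

lemma shift_closed_is_all:
  fixes S :: "int set" and p :: nat
  assumes p: "prime p" and d: "\<not> int p dvd d" and S: "S \<subseteq> {0..<int p}" "S \<noteq> {}"
    and closed: "\<And>s. s \<in> S \<Longrightarrow> (s + d) mod int p \<in> S"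
  shows "S = {0..<int p}"
proof (intro equalityI subsetI)
  fix t assume t: "t \<in> {0..<int p}"
  obtain s where s: "s \<in> S" using S by blast
  have orbit: "(s + int j * d) mod int p \<in> S" for j
  proof (induction j)
    case 0
    have "s mod int p = s" using s S(1) by auto
    then show ?case using s by simp
  next
    case (Suc j)
    have "(s + int (Suc j) * d) mod int p = ((s + int j * d) mod int p + d) mod int p"
      by (simp add: algebra_simps mod_simps)
    then show ?case using closed[OF Suc] by simp
  qed
  have "coprime d (int p)"
    using p d by (metis coprime_commute prime_imp_coprime prime_nat_int_transfer)
  then obtain e where e: "[d * e = 1] (mod int p)"
    using cong_solve_coprime_int by blast
  define j where "j = nat ((e * (t - s)) mod int p)"
  have p0: "int p > 0" using p prime_gt_0_nat by simp
  have "int j = (e * (t - s)) mod int p" unfolding j_def using p0 by simp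
  then have "[int j = e * (t - s)] (mod int p)" by (simp add: cong_def)
  then have "[s + int j * d = s + (e * (t - s)) * d] (mod int p)"
    by (intro cong_add cong_mult) auto
  moreover have "[s + (d * e) * (t - s) = s + 1 * (t - s)] (mod int p)"
    using e by (intro cong_add cong_mult) auto
  ultimately have "[s + int j * d = t] (mod int p)"
    by (metis (no_types, lifting) add.commute cong_trans diff_add_cancel mult.assoc mult.commute mult_1)
  then show "t \<in> S" using orbit[of j] t by (simp add: cong_def)
qed (use S in auto)

text \<open>
  The sumset \<open>{a\<^sub>1, b\<^sub>1} + ... + {a\<^sub>k, b\<^sub>k}\<close> modulo \<open>p\<close>.
\<close>

fun choice_sums :: "nat \<Rightarrow> (int \<times> int) list \<Rightarrow> int set" where
  "choice_sums p [] = {0}"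
| "choice_sums p ((a, b) # ps) =
     (\<lambda>s. (a + s) mod int p) ` choice_sums p ps \<union> (\<lambda>s. (b + s) mod int p) ` choice_sums p ps"

lemma choice_sums_subset: "p > 0 \<Longrightarrow> choice_sums p ps \<subseteq> {0..<int p}"
  by (induction p ps rule: choice_sums.induct) auto

lemma choice_sums_nonempty: "choice_sums p ps \<noteq> {}"
  by (induction p ps rule: choice_sums.induct) auto

lemma inj_on_shift_mod: "inj_on (\<lambda>s. (a + s) mod int p) {0..<int p}"
proof (rule inj_onI)
  fix s t assume st: "s \<in> {0..<int p}" "t \<in> {0..<int p}" "(a + s) mod int p = (a + t) mod int p"
  then have "[a + s = a + t] (mod int p)" by (simp add: cong_def)
  then have "[s = t] (mod int p)" by (simp add: cong_add_lcancel)
  then show "s = t" using st by (simp add: cong_def)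
qed

text \<open>
  The case of two-element summands of the Cauchy-Davenport theorem. Adding \<open>{a, b}\<close> to \<open>S\<close>
  gives the union of two translates of \<open>S\<close>; if that is no larger than \<open>S\<close>, the translates agree and
  \<open>S\<close> is closed under the shift by \<open>b - a\<close>, hence is everything.
\<close>

lemma card_choice_sums:
  assumes p: "prime p" and "\<forall>(a, b) \<in> set ps. \<not> [a = b] (mod int p)"
  shows "min p (length ps + 1) \<le> card (choice_sums p ps)"
  using assms(2)
proof (induction ps)
  case Nil
  then show ?case by simp
next
  case (Cons ab ps)
  obtain a b where ab: "ab = (a, b)" by fastforce
  have p0: "p > 0" using p prime_gt_0_nat by blast
  define S where "S = choice_sums p ps"
  have S: "S \<subseteq> {0..<int p}" "S \<noteq> {}"
    using choice_sums_subset[OF p0] choice_sums_nonempty by (auto simp: S_def)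
  then have fin: "finite S" using finite_subset by blast
  have IH: "min p (length ps + 1) \<le> card S" using Cons unfolding S_def by auto
  define S1 S2 where "S1 = (\<lambda>s. (a + s) mod int p) ` S" and "S2 = (\<lambda>s. (b + s) mod int p) ` S"
  have c1: "card S1 = card S" "card S2 = card S"
    unfolding S1_def S2_def by (auto intro!: card_image inj_on_subset[OF inj_on_shift_mod S(1)])
  have un: "choice_sums p (ab # ps) = S1 \<union> S2" by (simp add: ab S_def S1_def S2_def)
  have finU: "finite (S1 \<union> S2)" using fin by (simp add: S1_def S2_def)
  show ?case
  proof (cases "S2 \<subseteq> S1")
    case False
    then have "card S1 < card (S1 \<union> S2)"
      using finU by (intro psubset_card_mono) auto
    then show ?thesis using IH c1 by (simp add: un min_def split: if_splits)
  next
    case True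
    have "S = {0..<int p}"
    proof (rule shift_closed_is_all[OF p _ S, of "b - a"])
      show "\<not> int p dvd b - a"
        using Cons.prems by (auto simp: ab cong_iff_dvd_diff dvd_diff_commute)
      fix s assume "s \<in> S"
      then have "(b + s) mod int p \<in> S1" using True by (auto simp: S2_def)
      then obtain s' where s': "s' \<in> S" "[b + s = a + s'] (mod int p)"
        by (auto simp: S1_def cong_def)
      have "[s + (b - a) = s'] (mod int p)"
        using s'(2) by (simp add: cong_iff_dvd_diff algebra_simps)
      then have "(s + (b - a)) mod int p = s'"
        using s'(1) S(1) by (auto simp: cong_def)
      then show "(s + (b - a)) mod int p \<in> S" using s'(1) by simp
    qed
    then have "card S = p" by simp
    then have "p \<le> card (S1 \<union> S2)"
      using c1 card_mono[OF finU, of S1] by simp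
    then show ?thesis by (simp add: un)
  qed
qed

lemma choice_sums_realised:
  assumes "t \<in> choice_sums p ps"
  shows "\<exists>N. N \<subseteq># mset (map fst ps) + mset (map snd ps) \<and> size N = length ps
    \<and> [\<Sum>\<^sub># N = t] (mod int p)"
  using assms
proof (induction p ps arbitrary: t rule: choice_sums.induct)
  case (1 p)
  then show ?case by auto
next
  case (2 p a b ps)
  then obtain c s where c: "c \<in> {a, b}" and s: "s \<in> choice_sums p ps" "t = (c + s) mod int p"
    by auto
  obtain N where N: "N \<subseteq># mset (map fst ps) + mset (map snd ps)" "size N = length ps"
    "[\<Sum>\<^sub># N = s] (mod int p)"
    using 2(1,2) s(1) by blast
  have "add_mset c N \<subseteq># mset (map fst ((a, b) # ps)) + mset (map snd ((a, b) # ps))"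
  proof -
    have "add_mset c N \<subseteq># {#b, a#} + (mset (map fst ps) + mset (map snd ps))"
      using mset_subset_eq_mono_add[OF mset_subset_eq_single N(1), of c "{#b, a#}"] c by auto
    then show ?thesis by simp
  qed
  moreover have "[\<Sum>\<^sub># (add_mset c N) = t] (mod int p)"
    using N(3) s(2) by (simp add: cong_def) (metis mod_add_right_eq)
  ultimately show ?case using N(2) by (intro exI[of _ "add_mset c N"]) simp
qed

text \<open>
  The theorem is stated for integers rather than residues so that, in the step
  to a product, block sums can be divided by \<open>m\<close> before they are reduced modulo \<open>k\<close>.
\<close>

definition egz :: "nat \<Rightarrow> bool" where
  "egz n \<longleftrightarrow> (\<forall>M :: int multiset. size M = 2 * n - 1 \<longrightarrow>
     (\<exists>N. N \<subseteq># M \<and> size N = n \<and> int n dvd \<Sum>\<^sub># N))"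

lemma sum_list_constant_residue:
  assumes "\<forall>x \<in> set xs. [x = c] (mod m)"
  shows "[sum_list xs = int (length xs) * c] (mod m)"
  using assms
proof (induction xs)
  case (Cons x xs)
  then have "[x + sum_list xs = c + int (length xs) * c] (mod m)"
    by (intro cong_add) auto
  then show ?case by (simp add: algebra_simps)
qed simp

text \<open>
  After sorting by residue, two congruent terms at distance \<open>p - 1\<close> force all \<open>p\<close> terms from one to
  the other to be congruent, and their sum vanishes. Otherwise term \<open>i\<close> and term \<open>i + (p - 1)\<close>, for
  \<open>i < p - 1\<close>, form \<open>p - 1\<close> pairs of incongruent terms covering all but the last term \<open>c\<close>.
  By the growth of sumsets some choice from the pairs sums to \<open>-c\<close>.
\<close>

lemma egz_prime:
  assumes p: "prime p"
  shows "egz p"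
  unfolding egz_def
proof (intro allI impI)
  fix M :: "int multiset"
  assume size: "size M = 2 * p - 1"
  have p2: "p \<ge> 2" using p prime_ge_2_nat by blast
  obtain xs0 where xs0: "mset xs0 = M" using ex_mset by blast
  define xs where "xs = sort_key (\<lambda>x. x mod int p) xs0"
  have M: "mset xs = M" by (simp add: xs_def xs0)
  have len: "length xs = 2 * p - 1" using size M by (metis size_mset)
  have mono: "xs ! i mod int p \<le> xs ! j mod int p" if "i \<le> j" "j < length xs" for i j
  proof -
    have "sorted (map (\<lambda>x. x mod int p) xs)" by (simp add: xs_def)
    from sorted_nth_mono[OF this, of i j] that show ?thesis by simp
  qed
  show "\<exists>N. N \<subseteq># M \<and> size N = p \<and> int p dvd \<Sum>\<^sub># N"
  proof (cases "\<exists>i < p - 1. [xs ! i = xs ! (i + (p - 1))] (mod int p)")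
    case True
    then obtain i where i: "i < p - 1" "xs ! i mod int p = xs ! (i + (p - 1)) mod int p"
      by (auto simp: cong_def)
    define ys where "ys = take p (drop i xs)"
    have ys: "length ys = p" using i len by (simp add: ys_def)
    have "[y = xs ! i] (mod int p)" if "y \<in> set ys" for y
    proof -
      obtain j where "j < length ys" "y = ys ! j"
        using \<open>y \<in> set ys\<close> by (metis in_set_conv_nth)
      then have j: "j < p" "y = xs ! (i + j)"
        using ys i len by (simp_all add: ys_def)
      have "xs ! i mod int p \<le> y mod int p" using mono[of i "i + j"] j i len by simp
      moreover have "y mod int p \<le> xs ! (i + (p - 1)) mod int p"
        using mono[of "i + j" "i + (p - 1)"] j i len by simp
      ultimately show ?thesis using i by (simp add: cong_def)
    qed
    then have "[sum_list ys = int p * (xs ! i)] (mod int p)"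
      using sum_list_constant_residue ys by metis
    then have "int p dvd \<Sum>\<^sub># (mset ys)"
      by (metis cong_dvd_iff dvd_triv_left sum_mset_sum_list)
    moreover have "mset ys \<subseteq># M"
      using mset_segment_subseteq[of p i xs] by (simp add: ys_def M)
    ultimately show ?thesis using ys by (metis size_mset)
  next
    case False
    define ps where "ps = zip (take (p - 1) xs) (take (p - 1) (drop (p - 1) xs))"
    define c where "c = xs ! (2 * p - 2)"
    have lps: "length ps = p - 1" using len p2 by (simp add: ps_def)
    have "\<not> [a = b] (mod int p)" if "(a, b) \<in> set ps" for a b
      using that False len by (auto simp: ps_def in_set_zip add.commute)
    then have "min p (length ps + 1) \<le> card (choice_sums p ps)"
      by (intro card_choice_sums[OF p]) auto
    then have "card {0..<int p} \<le> card (choice_sums p ps)" using lps p2 by simp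
    then have "choice_sums p ps = {0..<int p}"
      by (intro card_seteq) (use choice_sums_subset p2 in auto)
    then have "(- c) mod int p \<in> choice_sums p ps" using p2 by simp
    from choice_sums_realised[OF this] obtain N where
      N: "N \<subseteq># mset (map fst ps) + mset (map snd ps)" "size N = p - 1"
         "[\<Sum>\<^sub># N = (- c) mod int p] (mod int p)"
      using lps by auto
    have "xs = map fst ps @ map snd ps @ [c]"
    proof -
      have "length (drop (2 * p - 2) xs) = 1" using len p2 by simp
      then have "drop (2 * p - 2) xs = [c]"
        using len p2 Cons_nth_drop_Suc[of "2 * p - 2" xs] by (simp add: c_def)
      moreover have "xs = take (p - 1) xs @ take (p - 1) (drop (p - 1) xs) @ drop (p - 1) (drop (p - 1) xs)"
        by (simp only: append_take_drop_id)
      moreover have "p - 1 + (p - 1) = 2 * p - 2" by simp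
      ultimately show ?thesis using len p2 by (simp add: ps_def)
    qed
    then have "M = add_mset c (mset (map fst ps) + mset (map snd ps))" using M by auto
    then have "add_mset c N \<subseteq># M" using N(1) by simp
    moreover have "int p dvd \<Sum>\<^sub># (add_mset c N)"
    proof -
      have "[\<Sum>\<^sub># N = - c] (mod int p)" using N(3) by (simp add: cong_def)
      then show ?thesis by (simp add: cong_iff_dvd_diff add.commute)
    qed
    ultimately show ?thesis using N(2) p2 by (intro exI[of _ "add_mset c N"]) simp
  qed
qed

text \<open>
  Blocks can be removed one after another: before the last one, \<open>2 k - 2\<close> blocks are gone
  and at least \<open>2 m - 1\<close> terms are left.
\<close>

lemma egz_blocks:
  assumes m: "egz m" "m > 0"
    and M: "size M \<ge> 2 * m * k - 1" and j: "j \<le> 2 * k - 1"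
  shows "\<exists>BB :: int multiset multiset. size BB = j \<and> \<Sum>\<^sub># BB \<subseteq># M
    \<and> (\<forall>B \<in># BB. size B = m \<and> int m dvd \<Sum>\<^sub># B)"
  using j
proof (induction j)
  case 0
  then show ?case by (intro exI[of _ "{#}"]) simp
next
  case (Suc j)
  then obtain BB where BB: "size BB = j" "\<Sum>\<^sub># BB \<subseteq># M"
    "\<forall>B \<in># BB. size B = m \<and> int m dvd \<Sum>\<^sub># B" by auto
  have "size (\<Sum>\<^sub># BB) = j * m"
    using BB(1,3) by (induction BB arbitrary: j) auto
  moreover have "j * m + (2 * m - 1) \<le> 2 * m * k - 1"
  proof -
    have "(j + 2) * m \<le> (2 * k) * m" using Suc.prems by (intro mult_right_mono) auto
    then show ?thesis using m(2) by (simp add: algebra_simps)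
  qed
  ultimately have "2 * m - 1 \<le> size (M - \<Sum>\<^sub># BB)"
    using M BB(2) by (simp add: size_Diff_submset)
  then obtain M' where M': "M' \<subseteq># M - \<Sum>\<^sub># BB" "size M' = 2 * m - 1"
    using submset_of_size by metis
  then obtain B where B: "B \<subseteq># M'" "size B = m" "int m dvd \<Sum>\<^sub># B"
    using m(1) unfolding egz_def by blast
  have "B + \<Sum>\<^sub># BB \<subseteq># (M - \<Sum>\<^sub># BB) + \<Sum>\<^sub># BB"
    using B(1) M'(1) by (intro mset_subset_eq_mono_add) auto
  then have "B + \<Sum>\<^sub># BB \<subseteq># M"
    by (simp only: subset_mset.diff_add[OF BB(2)])
  then show ?case using BB B by (intro exI[of _ "add_mset B BB"]) auto
qed

text \<open>
  Among \<open>2 k - 1\<close> disjoint blocks of size \<open>m\<close> with sums divisible by \<open>m\<close>, the property for \<open>k\<close>,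
  applied to the sums divided by \<open>m\<close>, selects \<open>k\<close> blocks.
\<close>

lemma egz_mult:
  assumes "egz m" "egz k" "m > 0" "k > 0"
  shows "egz (m * k)"
  unfolding egz_def
proof (intro allI impI)
  fix M :: "int multiset"
  assume "size M = 2 * (m * k) - 1"
  then obtain BB :: "int multiset multiset" where BB: "size BB = 2 * k - 1" "\<Sum>\<^sub># BB \<subseteq># M"
    "\<forall>B \<in># BB. size B = m \<and> int m dvd \<Sum>\<^sub># B"
    using egz_blocks[OF assms(1,3), of k M "2 * k - 1"] by (auto simp: mult.assoc)
  define f where "f B = \<Sum>\<^sub># B div int m" for B
  obtain N where "N \<subseteq># image_mset f BB" and N: "size N = k" "int k dvd \<Sum>\<^sub># N"
    using assms(2) BB(1) unfolding egz_def by (metis size_image_mset)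
  then obtain CC where CC: "CC \<subseteq># BB" "N = image_mset f CC"
    by (metis image_mset_eq_plusD mset_subset_eq_add_left mset_subset_eq_exists_conv)
  have CC': "\<forall>B \<in># CC. size B = m \<and> int m dvd \<Sum>\<^sub># B" using BB(3) CC(1) by (meson mset_subset_eqD)
  then have "size (\<Sum>\<^sub># CC) = m * size CC" by (induction CC) auto
  moreover from CC' have "\<Sum>\<^sub># (\<Sum>\<^sub># CC) = int m * \<Sum>\<^sub># (image_mset f CC)"
    by (induction CC) (auto simp: f_def distrib_left)
  moreover have "\<Sum>\<^sub># CC \<subseteq># M"
    using CC(1) BB(2) by (metis mset_subset_eq_add_left mset_subset_eq_exists_conv subset_mset.order_trans sum_mset.union)
  ultimately show "\<exists>N. N \<subseteq># M \<and> size N = m * k \<and> int (m * k) dvd \<Sum>\<^sub># N"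
    using N CC(2) by (intro exI[of _ "\<Sum>\<^sub># CC"]) auto
qed

theorem erdos_ginzburg_ziv: "n > 0 \<Longrightarrow> egz n"
proof (induction n rule: less_induct)
  case (less n)
  show ?case
  proof (cases "n = 1")
    case True
    then show ?thesis by (auto simp: egz_def)
  next
    case False
    then obtain p where p: "prime p" "p dvd n" using prime_factor_nat by blast
    then obtain k where k: "n = p * k" by blast
    have "k > 0" "p > 1" using less.prems k p prime_gt_1_nat by auto
    then have "k < n" using k by simp
    with less.IH \<open>k > 0\<close> have "egz k" by blast
    then show ?thesis using egz_mult[OF egz_prime[OF p(1)]] k \<open>k > 0\<close> \<open>p > 1\<close> by simp
  qed
qed

section \<open>Zero-sum constants for subsequences and consecutive subsequences\<close>

definition flatten_pairs :: "('a \<times> 'a) list \<Rightarrow> 'a list" where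
  "flatten_pairs ps = concat (map (\<lambda>(a, b). [a, b]) ps)"

lemma flatten_pairs_simps [simp]:
  "flatten_pairs [] = []"
  "flatten_pairs ((a, b) # ps) = a # b # flatten_pairs ps"
  "flatten_pairs (ps @ qs) = flatten_pairs ps @ flatten_pairs qs"
  by (simp_all add: flatten_pairs_def)

lemma mset_flatten_pairs:
  "mset (flatten_pairs ps) = image_mset fst (mset ps) + image_mset snd (mset ps)"
  by (induction ps) auto

lemma flatten_pairs_surj: "length xs = 2 * k \<Longrightarrow> \<exists>ps. length ps = k \<and> flatten_pairs ps = xs"
proof (induction k arbitrary: xs)
  case (Suc k)
  then obtain a b ys where xs: "xs = a # b # ys" "length ys = 2 * k"
    by (auto simp: length_Suc_conv)
  then obtain ps where "length ps = k" "flatten_pairs ps = ys" using Suc.IH by blast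
  then show ?case using xs by (intro exI[of _ "(a, b) # ps"]) simp
qed simp

lemma subseq_flatten_pairs:
  assumes "subseq qs ps"
  shows "subseq (flatten_pairs qs) (flatten_pairs ps)"
  using assms
proof (induction rule: list_emb.induct)
  case (list_emb_Nil ps)
  then show ?case by simp
next
  case (list_emb_Cons qs ps p)
  then show ?case by (cases p) (auto simp del: subseq_Cons2_iff)
next
  case (list_emb_Cons2 q p qs ps)
  then show ?case by (cases p) auto
qed

text \<open>
  The relation \<open>R\<close> is the notion of subsequence: \<open>subseq\<close> for the Davenport constants and
  \<open>sublist\<close> for their consecutive analogues. The constants of the third kind arise by
  putting the length condition into \<open>P\<close>.
\<close>

definition hits :: "(int list \<Rightarrow> int list \<Rightarrow> bool) \<Rightarrow> nat \<Rightarrow> (int list \<Rightarrow> bool) \<Rightarrow> nat \<Rightarrow> bool" where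
  "hits R n P k \<longleftrightarrow> (\<forall>xs \<in> seqs n k. \<exists>ys. ys \<noteq> [] \<and> R ys xs \<and> P ys)"

definition threshold :: "(int list \<Rightarrow> int list \<Rightarrow> bool) \<Rightarrow> nat \<Rightarrow> (int list \<Rightarrow> bool) \<Rightarrow> nat" where
  "threshold R n P = (LEAST k. 0 < k \<and> hits R n P k)"

lemma constants_as_thresholds:
  "D_const n P = threshold subseq n P"
  "C_const n P = threshold sublist n P"
  "E_const n P = threshold subseq n (\<lambda>ys. length ys = n \<and> P ys)"
  unfolding D_const_def C_const_def E_const_def threshold_def hits_def by simp_all

lemma seqs_iff: "xs \<in> seqs n k \<longleftrightarrow> length xs = k \<and> set xs \<subseteq> {0..<int n}"
  by (simp add: seqs_def carrier_Zn)

text \<open>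
  The common properties of \<open>subseq\<close> and \<open>sublist\<close> that carry the bounds between
  the signed and the balanced constants. The last one
  says that a selection of pairs, made by means of a function of the pairs, is also a selection of
  the underlying terms.
\<close>

locale selection =
  fixes R :: "int list \<Rightarrow> int list \<Rightarrow> bool"
  assumes R_sublist: "sublist ys xs \<Longrightarrow> R ys xs"
    and R_trans: "R zs ys \<Longrightarrow> R ys xs \<Longrightarrow> R zs xs"
    and R_Nil: "R ys [] \<Longrightarrow> ys = []"
    and R_filter: "R ys xs \<Longrightarrow> R (filter Q ys) (filter Q xs)"
    and R_pairs: "R ys (map f ps) \<Longrightarrow> \<exists>qs. ys = map f qs \<and> R (flatten_pairs qs) (flatten_pairs ps)"
begin

lemma hits_pos: "hits R n P k \<Longrightarrow> 0 < k"
proof (rule ccontr)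
  assume "hits R n P k" "\<not> 0 < k"
  then have "hits R n P 0" by simp
  moreover have "[] \<in> seqs n 0" by (simp add: seqs_iff)
  ultimately show False using R_Nil unfolding hits_def by blast
qed

lemma hits_mono:
  assumes "hits R n P k" "k \<le> l"
  shows "hits R n P l"
  unfolding hits_def
proof
  fix xs assume xs: "xs \<in> seqs n l"
  then have "take k xs \<in> seqs n k"
    using assms(2) set_take_subset[of k xs] by (auto simp: seqs_iff)
  then obtain ys where "ys \<noteq> []" "R ys (take k xs)" "P ys"
    using assms(1) unfolding hits_def by blast
  then show "\<exists>ys. ys \<noteq> [] \<and> R ys xs \<and> P ys"
    using R_trans R_sublist sublist_take by blast
qed

text \<open>
  This reduces every comparison of constants to statements about fixed lengths; a least
  element is meaningful only once some length is known to work.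
\<close>

lemma threshold_le_iff:
  assumes "hits R n P K"
  shows "threshold R n P \<le> k \<longleftrightarrow> hits R n P k"
proof
  have "0 < threshold R n P \<and> hits R n P (threshold R n P)"
    unfolding threshold_def by (rule LeastI[of _ K]) (use assms hits_pos in blast)
  then show "threshold R n P \<le> k \<Longrightarrow> hits R n P k" using hits_mono by blast
  show "hits R n P k \<Longrightarrow> threshold R n P \<le> k"
    unfolding threshold_def by (rule Least_le) (use hits_pos in blast)
qed

text \<open>
  Two of the \<open>n + 1\<close> initial sums agree modulo \<open>n\<close>, so even with all weights equal to \<open>1\<close> there
  is a consecutive zero-sum.
\<close>

lemma hits_signed:
  assumes n: "n > 0"
  shows "hits R n (\<lambda>ys. signed_zero_sum n (mset ys)) n"
  unfolding hits_def
proof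
  fix xs assume "xs \<in> seqs n n"
  then have len: "length xs = n" by (simp add: seqs_iff)
  define g where "g i = sum_list (take i xs) mod int n" for i
  have "g ` {..n} \<subseteq> {0..<int n}" using n by (auto simp: g_def)
  then have "card (g ` {..n}) \<le> card {0..<int n}" by (intro card_mono) auto
  then have "\<not> inj_on g {..n}" by (intro pigeonhole) simp
  then obtain i j where ij: "i < j" "j \<le> n" "g i = g j"
    unfolding inj_on_def by (metis atMost_iff linorder_neqE_nat)
  define ys where "ys = take (j - i) (drop i xs)"
  have "take j xs = take i xs @ ys"
    using ij take_add[of i "j - i" xs] by (simp add: ys_def)
  then have "int n dvd sum_list ys"
    using ij(3) by (simp add: g_def mod_eq_dvd_iff dvd_diff_commute[of _ "sum_list (take i xs)"])
  then have "signed_zero_sum n (mset ys)"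
    unfolding signed_zero_sum_def
    by (intro exI[of _ "mset ys"] exI[of _ "{#}"]) (simp add: sum_mset_sum_list cong_0_iff)
  moreover have "ys \<noteq> []" using ij len by (simp add: ys_def)
  moreover have "R ys xs"
    unfolding ys_def by (intro R_sublist) (metis sublist_take sublist_drop sublist_order.order_trans)
  ultimately show "\<exists>ys. ys \<noteq> [] \<and> R ys xs \<and> signed_zero_sum n (mset ys)" by blast
qed

text \<open>
  In a zero-sum of the differences \<open>a - b\<close>, a pair with sign \<open>+\<close> contributes \<open>a\<close> to the positive
  and \<open>b\<close> to the negative part, a pair with sign \<open>-\<close> the other way round. Both parts have one element
  from each pair, so their sizes are even equal.
\<close>

lemma hits_balanced_double:
  assumes n: "n > 0" and hits: "hits R n (\<lambda>ys. signed_zero_sum n (mset ys)) k"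
  shows "hits R n (\<lambda>ys. balanced_zero_sum n (mset ys)) (2 * k)"
  unfolding hits_def
proof
  fix xs assume "xs \<in> seqs n (2 * k)"
  then obtain ps where ps: "length ps = k" "flatten_pairs ps = xs"
    using flatten_pairs_surj by (auto simp: seqs_iff)
  define f where "f = (\<lambda>(a, b). (a - b) mod int n)"
  have "map f ps \<in> seqs n k" using ps n by (auto simp: seqs_iff f_def)
  then obtain ys where ys: "ys \<noteq> []" "R ys (map f ps)" "signed_zero_sum n (mset ys)"
    using hits unfolding hits_def by blast
  obtain qs where qs: "ys = map f qs" "R (flatten_pairs qs) xs"
    using R_pairs[OF ys(2)] ps(2) by blast
  obtain P Q where "image_mset f (mset qs) = P + Q" and PQ: "[\<Sum>\<^sub># P = \<Sum>\<^sub># Q] (mod int n)"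
    using ys(3) qs(1) unfolding signed_zero_sum_def by auto
  then obtain P' Q' where P'Q': "mset qs = P' + Q'" "P = image_mset f P'" "Q = image_mset f Q'"
    by (blast dest: image_mset_eq_plusD)
  have diffs: "[\<Sum>\<^sub># (image_mset f S) = \<Sum>\<^sub># (image_mset fst S) - \<Sum>\<^sub># (image_mset snd S)] (mod int n)" for S
  proof (induction S)
    case (add p S)
    have "[f p = fst p - snd p] (mod int n)" by (simp add: f_def cong_def split: prod.split)
    from cong_add[OF this add] show ?case by (simp add: algebra_simps)
  qed simp
  have "[\<Sum>\<^sub># (image_mset fst P') - \<Sum>\<^sub># (image_mset snd P')
      = \<Sum>\<^sub># (image_mset fst Q') - \<Sum>\<^sub># (image_mset snd Q')] (mod int n)"
    using PQ diffs[of P'] diffs[of Q'] P'Q' by (metis cong_sym cong_trans)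
  then have "[\<Sum>\<^sub># (image_mset fst P' + image_mset snd Q')
      = \<Sum>\<^sub># (image_mset snd P' + image_mset fst Q')] (mod int n)"
    by (simp add: cong_iff_dvd_diff algebra_simps)
  then have "balanced_zero_sum n (mset (flatten_pairs qs))"
    unfolding balanced_zero_sum_def mset_flatten_pairs P'Q'(1)
    by (intro exI[of _ "image_mset fst P' + image_mset snd Q'"]
        exI[of _ "image_mset snd P' + image_mset fst Q'"]) (simp add: ac_simps)
  moreover have "flatten_pairs qs \<noteq> []"
    using ys(1) qs(1) by (cases qs) auto
  ultimately show "\<exists>ys. ys \<noteq> [] \<and> R ys xs \<and> balanced_zero_sum n (mset ys)"
    using qs(2) by blast
qed

text \<open>
  Zeros in \<open>ws\<close> do not help: a balanced selection would consist of at least two zeros, and by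
  passing to its first two terms it would contain \<open>[0, 0]\<close>, which the third condition on \<open>ws\<close> excludes.
\<close>

lemma not_hits_balanced_padded:
  assumes n: "n \<ge> 2"
    and none: "\<And>ys. ys \<noteq> [] \<Longrightarrow> R ys xs \<Longrightarrow> \<not> signed_zero_sum n (mset ys)"
    and ws: "ws \<in> seqs n l" "filter (\<lambda>x. x \<noteq> 0) ws = xs" "\<not> R [0, 0] ws"
  shows "\<not> hits R n (\<lambda>ys. balanced_zero_sum n (mset ys)) l"
proof
  assume "hits R n (\<lambda>ys. balanced_zero_sum n (mset ys)) l"
  then obtain ys where ys: "ys \<noteq> []" "R ys ws" "balanced_zero_sum n (mset ys)"
    using ws(1) unfolding hits_def by blast
  have "signed_zero_sum n (mset (filter (\<lambda>x. x \<noteq> 0) ys))"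
    using signed_drop_zeros[OF balanced_imp_signed[OF ys(3)]] by simp
  moreover have "R (filter (\<lambda>x. x \<noteq> 0) ys) xs" using R_filter[OF ys(2)] ws(2) by metis
  ultimately have "filter (\<lambda>x. x \<noteq> 0) ys = []" using none by blast
  then have zeros: "\<forall>y \<in> set ys. y = 0" by (simp add: filter_empty_conv)
  have "2 \<le> length ys" using balanced_size_ge_2[OF ys(3) _ n] ys(1) by simp
  then obtain y z zs where "ys = y # z # zs"
    by (metis Suc_le_length_iff numeral_2_eq_2)
  with zeros have "ys = [0, 0] @ zs" by simp
  then have "R [0, 0] ys" by (metis R_sublist sublist_append_rightI)
  then show False using R_trans ys(2) ws(3) by blast
qed

lemma threshold_balanced_le:
  assumes "n > 0"
  shows "threshold R n (\<lambda>ys. balanced_zero_sum n (mset ys))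
    \<le> 2 * threshold R n (\<lambda>ys. signed_zero_sum n (mset ys))"
proof -
  have signed: "hits R n (\<lambda>ys. signed_zero_sum n (mset ys))
      (threshold R n (\<lambda>ys. signed_zero_sum n (mset ys)))"
    using threshold_le_iff[OF hits_signed[OF assms]] by blast
  show ?thesis
    using threshold_le_iff hits_balanced_double[OF assms signed] by blast
qed

end

interpretation subseq: selection subseq
proof
  fix ys :: "int list" and f :: "int \<times> int \<Rightarrow> int" and ps
  assume "subseq ys (map f ps)"
  then obtain N where "ys = nths (map f ps) N" by (auto simp: subseq_conv_nths)
  then have "ys = map f (nths ps N)" by (simp add: nths_map)
  then show "\<exists>qs. ys = map f qs \<and> subseq (flatten_pairs qs) (flatten_pairs ps)"
    using subseq_flatten_pairs subseq_conv_nths by blast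
qed (auto intro: subseq_order.order_trans)

interpretation sublist: selection sublist
proof
  fix ys :: "int list" and f :: "int \<times> int \<Rightarrow> int" and ps
  assume "sublist ys (map f ps)"
  then obtain qs us vs where "ps = us @ qs @ vs" "ys = map f qs"
    by (auto simp: sublist_def map_eq_append_conv append_eq_map_conv)
  then show "\<exists>qs. ys = map f qs \<and> sublist (flatten_pairs qs) (flatten_pairs ps)" by auto
next
  fix ys xs :: "int list" and Q
  assume "sublist ys xs"
  then obtain us vs where "xs = us @ ys @ vs" by (auto simp: sublist_def)
  then show "sublist (filter Q ys) (filter Q xs)" by simp
qed (auto intro: sublist_order.order_trans)

lemma nonzero_of_no_signed:
  assumes "\<And>ys. ys \<noteq> [] \<Longrightarrow> sublist ys xs \<Longrightarrow> \<not> signed_zero_sum n (mset ys)"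
  shows "0 \<notin> set xs"
proof
  assume "0 \<in> set xs"
  then have "sublist [0] xs" by (metis append_Cons append_Nil split_list sublist_appendI)
  moreover have "signed_zero_sum n (mset [0])"
    unfolding signed_zero_sum_def by (intro exI[of _ "{#0#}"] exI[of _ "{#}"]) simp
  ultimately show False using assms by blast
qed

section \<open>Lower bounds by inserting zeros\<close>

lemma D_lower:
  assumes n: "n \<ge> 2"
  shows "threshold subseq n (\<lambda>ys. signed_zero_sum n (mset ys)) + 1
    \<le> threshold subseq n (\<lambda>ys. balanced_zero_sum n (mset ys))"
proof -
  define d where "d = threshold subseq n (\<lambda>ys. signed_zero_sum n (mset ys))"
  have iff: "d \<le> k \<longleftrightarrow> hits subseq n (\<lambda>ys. signed_zero_sum n (mset ys)) k" for k
    unfolding d_def using n by (intro subseq.threshold_le_iff[OF subseq.hits_signed]) simp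
  have d0: "d > 0" using iff[of d] subseq.hits_pos by blast
  then have "\<not> hits subseq n (\<lambda>ys. signed_zero_sum n (mset ys)) (d - 1)" using iff[of "d - 1"] d0 by linarith
  then obtain xs where xs: "xs \<in> seqs n (d - 1)"
    and none: "\<And>ys. ys \<noteq> [] \<Longrightarrow> subseq ys xs \<Longrightarrow> \<not> signed_zero_sum n (mset ys)"
    unfolding hits_def by blast
  have nz: "0 \<notin> set xs" using nonzero_of_no_signed none sublist_imp_subseq by metis
  have "\<not> hits subseq n (\<lambda>ys. balanced_zero_sum n (mset ys)) d"
  proof (rule subseq.not_hits_balanced_padded[OF n none])
    show "0 # xs \<in> seqs n d" using xs d0 n by (auto simp: seqs_iff)
    show "filter (\<lambda>x. x \<noteq> 0) (0 # xs) = xs" using nz by (simp add: filter_id_conv) metis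
    show "\<not> subseq [0, 0] (0 # xs)" using nz by (simp add: subseq_singleton_left)
  qed
  then show ?thesis
    using subseq.threshold_le_iff[OF subseq.hits_balanced_double[OF _ subseq.hits_signed], of n d] n
    unfolding d_def by simp
qed

lemma C_lower:
  assumes n: "n \<ge> 2"
  shows "2 * threshold sublist n (\<lambda>ys. signed_zero_sum n (mset ys))
    \<le> threshold sublist n (\<lambda>ys. balanced_zero_sum n (mset ys))"
proof -
  define c where "c = threshold sublist n (\<lambda>ys. signed_zero_sum n (mset ys))"
  have iff: "c \<le> k \<longleftrightarrow> hits sublist n (\<lambda>ys. signed_zero_sum n (mset ys)) k" for k
    unfolding c_def using n by (intro sublist.threshold_le_iff[OF sublist.hits_signed]) simp
  have c0: "c > 0" using iff[of c] sublist.hits_pos by blast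
  then have "\<not> hits sublist n (\<lambda>ys. signed_zero_sum n (mset ys)) (c - 1)" using iff[of "c - 1"] c0 by linarith
  then obtain xs where xs: "xs \<in> seqs n (c - 1)"
    and none: "\<And>ys. ys \<noteq> [] \<Longrightarrow> sublist ys xs \<Longrightarrow> \<not> signed_zero_sum n (mset ys)"
    unfolding hits_def by blast
  have nz: "0 \<notin> set xs" using nonzero_of_no_signed none by blast
  define ws where "ws = 0 # flatten_pairs (map (\<lambda>x. (x, 0)) xs)"
  have len: "length (flatten_pairs (map (\<lambda>x. (x, 0)) us)) = 2 * length us" for us :: "int list"
    by (induction us) auto
  have set: "set (flatten_pairs (map (\<lambda>x. (x, 0)) us)) \<subseteq> insert 0 (set us)" for us :: "int list"
    by (induction us) auto
  have "\<not> hits sublist n (\<lambda>ys. balanced_zero_sum n (mset ys)) (2 * c - 1)"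
  proof (rule sublist.not_hits_balanced_padded[OF n none])
    show "ws \<in> seqs n (2 * c - 1)"
      using xs c0 n set[of xs] by (auto simp: seqs_iff ws_def len)
    show "filter (\<lambda>x. x \<noteq> 0) ws = xs" unfolding ws_def using nz by (induction xs) auto
    show "\<not> sublist [0, 0] ws"
      unfolding ws_def using nz by (induction xs) (auto simp: sublist_Cons_right)
  qed
  then show ?thesis
    using sublist.threshold_le_iff[OF sublist.hits_balanced_double[OF _ sublist.hits_signed], of n "2 * c - 1"] n
    unfolding c_def by simp
qed

section \<open>Zero-sums of length n\<close>

lemma submset_imp_subseq:
  assumes "N \<subseteq># mset xs"
  shows "\<exists>ys. subseq ys xs \<and> mset ys = N"
  using assms
proof (induction xs arbitrary: N)
  case (Cons x xs)
  show ?case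
  proof (cases "x \<in># N")
    case True
    then obtain N' where N': "N = add_mset x N'" by (metis mset_add)
    then have "N' \<subseteq># mset xs" using Cons.prems by simp
    then obtain ys where "subseq ys xs" "mset ys = N'" using Cons.IH by blast
    then show ?thesis using N' by (intro exI[of _ "x # ys"]) simp
  next
    case False
    then have "N \<subseteq># mset xs"
      using Cons.prems by (metis mset.simps(2) add_mset_remove_trivial diff_single_trivial subset_eq_diff_conv add_mset_add_single)
    then show ?thesis using Cons.IH by (metis list_emb_Cons)
  qed
qed simp

lemma subseq_imp_submset: "subseq ys xs \<Longrightarrow> mset ys \<subseteq># mset xs"
  by (induction rule: list_emb.induct) (auto intro: subset_mset.order_trans)

text \<open>
  For arbitrary positions the order of the terms is irrelevant, so from here on sequences can
  be replaced by multisets, on which disjoint zero-sums are easily removed and joined.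
\<close>

lemma hits_subseq_iff:
  "hits subseq n (\<lambda>ys. Q (mset ys)) k \<longleftrightarrow>
     (\<forall>M. size M = k \<and> set_mset M \<subseteq> {0..<int n} \<longrightarrow> (\<exists>N. N \<noteq> {#} \<and> N \<subseteq># M \<and> Q N))"
proof (intro iffI allI impI)
  fix M assume h: "hits subseq n (\<lambda>ys. Q (mset ys)) k" and M: "size M = k \<and> set_mset M \<subseteq> {0..<int n}"
  obtain xs where xs: "mset xs = M" using ex_mset by blast
  then have "xs \<in> seqs n k" using M by (auto simp: seqs_iff)
  then obtain ys where "ys \<noteq> []" "subseq ys xs" "Q (mset ys)" using h unfolding hits_def by blast
  then show "\<exists>N. N \<noteq> {#} \<and> N \<subseteq># M \<and> Q N"
    using subseq_imp_submset xs by (intro exI[of _ "mset ys"]) auto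
next
  assume h: "\<forall>M. size M = k \<and> set_mset M \<subseteq> {0..<int n} \<longrightarrow> (\<exists>N. N \<noteq> {#} \<and> N \<subseteq># M \<and> Q N)"
  show "hits subseq n (\<lambda>ys. Q (mset ys)) k"
    unfolding hits_def
  proof
    fix xs assume "xs \<in> seqs n k"
    then obtain N where "N \<noteq> {#}" "N \<subseteq># mset xs" "Q N"
      using h[rule_format, of "mset xs"] by (auto simp: seqs_iff)
    then show "\<exists>ys. ys \<noteq> [] \<and> subseq ys xs \<and> Q (mset ys)"
      by (metis submset_imp_subseq mset.simps(1))
  qed
qed

lemma hits_length_iff:
  "hits subseq n (\<lambda>ys. length ys = l \<and> Q (mset ys)) k \<longleftrightarrow>
     (\<forall>M. size M = k \<and> set_mset M \<subseteq> {0..<int n} \<longrightarrow>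
        (\<exists>N. N \<noteq> {#} \<and> N \<subseteq># M \<and> size N = l \<and> Q N))"
  using hits_subseq_iff[of n "\<lambda>N. size N = l \<and> Q N" k] by simp

text \<open>
  The sizes of the two parts add up to \<open>n\<close> and agree modulo \<open>n\<close>, so \<open>n\<close> divides twice either of
  them; for odd \<open>n\<close> this makes one part empty.
\<close>

lemma balanced_iff_sum_zero:
  assumes "odd n" "size M = n"
  shows "balanced_zero_sum n M \<longleftrightarrow> int n dvd \<Sum>\<^sub># M"
proof
  assume "balanced_zero_sum n M"
  then obtain P Q where PQ: "M = P + Q" "[\<Sum>\<^sub># P = \<Sum>\<^sub># Q] (mod int n)" "[size P = size Q] (mod n)"
    unfolding balanced_zero_sum_def by blast
  have sum: "size P + size Q = n" using PQ(1) assms(2) by simp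
  have "[size P + size P = size P + size Q] (mod n)" using PQ(3) by (intro cong_add) auto
  then have "n dvd 2 * size P" using sum by (simp add: cong_def mod_0_imp_dvd mult_2)
  then have "n dvd size P" using assms(1) by (simp add: coprime_dvd_mult_right_iff)
  then have "size P = 0 \<or> size P = n" using sum by (metis dvd_imp_le le_add1 le_antisym neq0_conv)
  then have "P = {#} \<or> Q = {#}" using sum by auto
  then show "int n dvd \<Sum>\<^sub># M" using PQ(1,2) by (auto simp: cong_0_iff dest: cong_sym)
next
  assume "int n dvd \<Sum>\<^sub># M"
  then show "balanced_zero_sum n M"
    unfolding balanced_zero_sum_def
    by (intro exI[of _ M] exI[of _ "{#}"]) (simp add: cong_0_iff assms(2))
qed

text \<open>
  The lower bound is attained by \<open>n - 1\<close> zeros together with \<open>n - 1\<close> ones.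
\<close>

lemma E_odd:
  assumes n: "n \<ge> 2" "odd n"
  shows "threshold subseq n (\<lambda>ys. length ys = n \<and> balanced_zero_sum n (mset ys)) = 2 * n - 1"
proof -
  have upper: "hits subseq n (\<lambda>ys. length ys = n \<and> balanced_zero_sum n (mset ys)) (2 * n - 1)"
    unfolding hits_length_iff
  proof (intro allI impI)
    fix M assume "size M = 2 * n - 1 \<and> set_mset M \<subseteq> {0..<int n}"
    then obtain N where "N \<subseteq># M" "size N = n" "int n dvd \<Sum>\<^sub># N"
      using erdos_ginzburg_ziv[of n] n(1) unfolding egz_def by auto
    then show "\<exists>N. N \<noteq> {#} \<and> N \<subseteq># M \<and> size N = n \<and> balanced_zero_sum n N"
      using balanced_iff_sum_zero[OF n(2)] n(1) by (intro exI[of _ N]) auto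
  qed
  have lower: "\<not> hits subseq n (\<lambda>ys. length ys = n \<and> balanced_zero_sum n (mset ys)) (2 * n - 2)"
  proof
    define M where "M = replicate_mset (n - 1) (0 :: int) + replicate_mset (n - 1) 1"
    assume "hits subseq n (\<lambda>ys. length ys = n \<and> balanced_zero_sum n (mset ys)) (2 * n - 2)"
    moreover have "size M = 2 * n - 2" "set_mset M \<subseteq> {0..<int n}"
      using n(1) by (auto simp: M_def)
    ultimately obtain N where N: "N \<subseteq># M" "size N = n" "balanced_zero_sum n N"
      unfolding hits_length_iff by blast
    obtain r s where rs: "N = replicate_mset r 0 + replicate_mset s 1" "r \<le> n - 1" "s \<le> n - 1"
    proof -
      have "set_mset N \<subseteq> {0, 1}" using set_mset_mono[OF N(1)] by (auto simp: M_def split: if_splits)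
      then have "N = replicate_mset (count N 0) 0 + replicate_mset (count N 1) 1"
        by (intro multiset_eqI) (auto simp: count_eq_zero_iff)
      moreover have "count N x \<le> n - 1" if "x = 0 \<or> x = 1" for x
        using mset_subset_eq_count[OF N(1), of x] that by (auto simp: M_def)
      ultimately show ?thesis using that by blast
    qed
    have "int n dvd int s"
      using N(3) balanced_iff_sum_zero[OF n(2) N(2)] rs(1) by simp
    then have "s = 0" using rs(3) n(1) by (auto dest: dvd_imp_le)
    then show False using N(2) rs n(1) by simp
  qed
  show ?thesis
    using subseq.threshold_le_iff[OF upper, of "2 * n - 1"] upper
      subseq.threshold_le_iff[OF upper, of "2 * n - 2"] lower n(1) by linarith
qed

lemma doubled_plus_set: "\<exists>E B. M = E + E + mset_set B \<and> finite B"
proof (induction M)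
  case empty
  show ?case by (intro exI[of _ "{#}"] exI[of _ "{}"]) simp
next
  case (add x M)
  then obtain E B where EB: "M = E + E + mset_set B" "finite B" by blast
  show ?case
  proof (cases "x \<in> B")
    case True
    then have "mset_set B = add_mset x (mset_set (B - {x}))" using EB(2) by (metis mset_set.remove)
    then show ?thesis using EB
      by (intro exI[of _ "add_mset x E"] exI[of _ "B - {x}"]) simp
  next
    case False
    then show ?thesis using EB by (intro exI[of _ E] exI[of _ "insert x B"]) simp
  qed
qed

text \<open>
  Here \<open>d\<close> plays the role of the balanced Davenport constant. Doubled elements are set aside as
  material for filling up in steps of two; only distinct elements are searched for further
  balanced zero-sums. The bound \<open>card B \<le> n\<close> guarantees enough doubled elements to absorb the
  uncertainty of up to \<open>d\<close> in the size of the last zero-sum found.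
\<close>

lemma E_even_upper:
  assumes n: "n \<ge> 2" "even n" and d: "d \<ge> 2"
    and hits: "hits subseq n (\<lambda>ys. balanced_zero_sum n (mset ys)) d"
  shows "hits subseq n (\<lambda>ys. length ys = n \<and> balanced_zero_sum n (mset ys)) (n - 2 + d)"
  unfolding hits_length_iff
proof (intro allI impI)
  fix M assume M: "size M = n - 2 + d \<and> set_mset M \<subseteq> {0..<int n}"
  obtain E B where EB: "M = E + E + mset_set B" "finite B" using doubled_plus_set by blast
  have "card B \<le> card {0..<int n}"
    using M EB by (intro card_mono) auto
  then have sizes: "2 * size E + card B = n - 2 + d" "card B \<le> n" using M EB by auto
  define good where "good V \<longleftrightarrow> V \<subseteq># mset_set B \<and> balanced_zero_sum n V \<and> size V \<le> n" for V
  have "good {#}" by (simp add: good_def balanced_empty)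
  then obtain V where V: "good V" and max: "\<And>V'. good V' \<Longrightarrow> size V' \<le> size V"
    using ex_has_greatest_nat[of good "{#}" size "Suc n"] by (auto simp: good_def)
  have evenV: "even (size V)" using V balanced_even_size n(2) unfolding good_def by blast
  have large: "n \<le> size V + 2 * size E"
  proof (rule ccontr)
    assume "\<not> ?thesis"
    \<comment> \<open>By parity the gap is at least two; this is where \<open>n - 2 + d\<close> suffices instead of \<open>n - 1 + d\<close>.\<close>
    then have small: "size V + 2 * size E + 2 \<le> n" using evenV n(2) by presburger
    have "size (mset_set B - V) = card B - size V"
      using V by (simp add: good_def size_Diff_submset)
    then have "d \<le> size (mset_set B - V)" using small sizes n(1) by linarith
    then obtain W where W: "W \<subseteq># mset_set B - V" "size W = d" using submset_of_size by metis
    have "set_mset W \<subseteq> {0..<int n}"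
    proof
      fix x assume "x \<in># W"
      then have "x \<in># mset_set B" using W(1) by (meson in_diffD mset_subset_eqD)
      then show "x \<in> {0..<int n}" using M EB by auto
    qed
    then obtain N where N: "N \<noteq> {#}" "N \<subseteq># W" "balanced_zero_sum n N"
      using hits W(2) unfolding hits_subseq_iff by blast
    have "size N \<le> d" using size_mset_mono[OF N(2)] W(2) by simp
    then have "size (V + N) \<le> n" using small sizes n(1) by simp
    moreover have "V + N \<subseteq># mset_set B"
    proof -
      have "V + N \<subseteq># V + (mset_set B - V)"
        using N(2) W(1) by (intro mset_subset_eq_mono_add) auto
      moreover have "V \<subseteq># mset_set B" using V by (simp add: good_def)
      ultimately show ?thesis by (simp only: subset_mset.add_diff_inverse)
    qed
    ultimately have "good (V + N)" using V N(3) balanced_add by (simp add: good_def)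
    then show False using max[of "V + N"] N(1) by simp
  qed
  have Vn: "size V \<le> n" using V by (simp add: good_def)
  have "(n - size V) div 2 \<le> size E" using large by linarith
  then obtain F where F: "F \<subseteq># E" "size F = (n - size V) div 2"
    using submset_of_size by metis
  have "size (F + F + V) = n"
    unfolding size_union F(2) using evenV n(2) Vn by presburger
  moreover have "F + F + V \<subseteq># M"
    using F(1) V unfolding EB(1) good_def by (intro mset_subset_eq_mono_add) auto
  moreover have "balanced_zero_sum n (F + F + V)"
    using V balanced_add balanced_double unfolding good_def by blast
  ultimately show "\<exists>N. N \<noteq> {#} \<and> N \<subseteq># M \<and> size N = n \<and> balanced_zero_sum n N"
    using n(1) by (intro exI[of _ "F + F + V"]) auto
qed

theorem mainTheorem1:
  fixes n :: nat and A :: "int set"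
  assumes "n \<ge> 2"
    and "A = {\<one>\<^bsub>Zn n\<^esub>, \<ominus>\<^bsub>Zn n\<^esub> \<one>\<^bsub>Zn n\<^esub>}"
  shows "(C_w1 A n = 2 * C_w A n \<and> D_w A n + 1 \<le> D_w1 A n \<and> D_w1 A n \<le> 2 * D_w A n)
    \<and> (odd n \<longrightarrow> E_w1 A n = 2 * n - 1)
    \<and> (even n \<longrightarrow> E_w A n \<le> E_w1 A n \<and> E_w1 A n \<le> n - 2 + D_w1 A n)"
proof -
  have n: "n \<ge> 2" "n > 0" using assms(1) by auto
  let ?S = "\<lambda>ys. signed_zero_sum n (mset ys)"
  let ?B = "\<lambda>ys. balanced_zero_sum n (mset ys)"
  let ?ES = "\<lambda>ys. length ys = n \<and> signed_zero_sum n (mset ys)"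
  let ?EB = "\<lambda>ys. length ys = n \<and> balanced_zero_sum n (mset ys)"
  have constants: "C_w A n = threshold sublist n ?S" "C_w1 A n = threshold sublist n ?B"
    "D_w A n = threshold subseq n ?S" "D_w1 A n = threshold subseq n ?B"
    "E_w A n = threshold subseq n ?ES" "E_w1 A n = threshold subseq n ?EB"
    unfolding C_w_def C_w1_def D_w_def D_w1_def E_w_def E_w1_def constants_as_thresholds
      weighted_zero_sum_iff[OF assms] by simp_all
  have C: "C_w1 A n = 2 * C_w A n"
    unfolding constants using sublist.threshold_balanced_le[OF n(2)] C_lower[OF n(1)] by (rule antisym)
  have D: "D_w A n + 1 \<le> D_w1 A n" "D_w1 A n \<le> 2 * D_w A n"
    unfolding constants using D_lower[OF n(1)] subseq.threshold_balanced_le[OF n(2)] .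
  have even_case: "E_w A n \<le> E_w1 A n \<and> E_w1 A n \<le> n - 2 + D_w1 A n" if "even n"
  proof -
    have DB: "hits subseq n ?B (D_w1 A n)"
      unfolding constants
      using subseq.threshold_le_iff[OF subseq.hits_balanced_double[OF n(2) subseq.hits_signed[OF n(2)]]]
      by blast
    have "hits subseq n ?S (D_w A n)"
      unfolding constants using subseq.threshold_le_iff[OF subseq.hits_signed[OF n(2)]] by blast
    then have "2 \<le> D_w1 A n" using subseq.hits_pos D(1) by force
    then have EB: "hits subseq n ?EB (n - 2 + D_w1 A n)"
      using E_even_upper[OF n(1) that _ DB] by blast
    then have "hits subseq n ?EB (E_w1 A n)"
      unfolding constants using subseq.threshold_le_iff by blast
    then have ES: "hits subseq n ?ES (E_w1 A n)"
      unfolding hits_def using balanced_imp_signed by blast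
    show ?thesis
      using subseq.threshold_le_iff[OF ES, of "E_w1 A n"] ES
        subseq.threshold_le_iff[OF EB, of "n - 2 + D_w1 A n"] EB
      unfolding constants by blast
  qed
  show ?thesis using C D even_case E_odd[OF n(1)] constants(6) by simp
qed

end
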